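(* Let $(x_0,y_0)\in\mathbb{R}^2$ and let $f(x,y)$ and $g(x,y)$ be two real-valued functions defined and twice differentiable in some neighborhood of the point $(x_0,y_0)$ and infinitely small of the second order at $(x_0,y_0)$. Suppose in addition that all the second-order partial derivatives $f''_{xx},f''_{xy},f''_{yx},f''_{yy},g''_{xx},g''_{xy},g''_{yx},g''_{yy}$ are not equal to zero at $(x_0,y_0)$. Let $k$ be a non-zero real number. Then the limit $\lim\limits_{(x,y)\to(x_0,y_0)}\frac{f(x,y)}{g(x,y)}$ exists and equals $k$ if and only if $$\frac{f''_{xx}(x_0,y_0)}{g''_{xx}(x_0,y_0)}=\frac{f''_{xy}(x_0,y_0)}{g''_{xy}(x_0,y_0)}=\frac{f''_{yx}(x_0,y_0)}{g''_{yx}(x_0,y_0)}=\frac{f''_{yy}(x_0,y_0)}{g''_{yy}(x_0,y_0)}=k.$$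
   Context: For an integer $n>1$, a function $f(x,y)$ is called infinitely small of order $n$ at the point $(x_0,y_0)$ if $\lim_{(x,y)\to(x_0,y_0)}f(x,y)=0$, ${\rm d}^i f(x_0,y_0)=0$ for $i\in\{1,\ldots,n-1\}$, and ${\rm d}^n f(x_0,y_0)\neq 0$, where ${\rm d}^i f$ is the $i$-th order differential of $f$. In particular, infinitely small of the second order means that $f$ tends to $0$ at $(x_0,y_0)$, its first differential vanishes there, and its second differential does not vanish there.
   Formalization: "Second differential does not vanish" is taken to mean d²f(dx,dy) ≠ 0 and d²g(dx,dy) ≠ 0 for every (dx,dy) ≠ (0,0); with "not identically zero" the claim fails, e.g. g = x²+4xy+y², f = kg+x³ at the origin. *)

theory Defs
  imports "HOL-Analysis.Analysis"
begin

definition partial_x :: "(real \<times> real \<Rightarrow> real) \<Rightarrow> real \<times> real \<Rightarrow> real" where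
  "partial_x f p = deriv (\<lambda>x. f (x, snd p)) (fst p)"

definition partial_y :: "(real \<times> real \<Rightarrow> real) \<Rightarrow> real \<times> real \<Rightarrow> real" where
  "partial_y f p = deriv (\<lambda>y. f (fst p, y)) (snd p)"

text \<open>Subscripts are read from left to right: the mixed derivative with subscript \<open>xy\<close>
  differentiates in \<open>x\<close> first.\<close>

abbreviation "partial_xx f \<equiv> partial_x (partial_x f)"
abbreviation "partial_xy f \<equiv> partial_y (partial_x f)"
abbreviation "partial_yx f \<equiv> partial_x (partial_y f)"
abbreviation "partial_yy f \<equiv> partial_y (partial_y f)"

text \<open>Meant for open \<open>U\<close>: \<open>at p\<close> is not restricted to \<open>U\<close>.\<close>

definition twice_differentiable_on ::
    "(real \<times> real \<Rightarrow> real) \<Rightarrow> (real \<times> real) set \<Rightarrow> bool" where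
  "twice_differentiable_on f U \<longleftrightarrow>
    (\<exists>f' :: real \<times> real \<Rightarrow> (real \<times> real) \<Rightarrow>\<^sub>L real.
      (\<forall>p\<in>U. (f has_derivative blinfun_apply (f' p)) (at p)) \<and>
      (\<forall>p\<in>U. f' differentiable (at p)))"

text \<open>The second differential is the differential of the first one, taken with the increment
  \<open>h = (dx, dy)\<close> held fixed; it is a quadratic form in \<open>h\<close>.\<close>

definition first_differential ::
    "(real \<times> real \<Rightarrow> real) \<Rightarrow> real \<times> real \<Rightarrow> real \<times> real \<Rightarrow> real" where
  "first_differential f p h = frechet_derivative f (at p) h"

definition second_differential ::
    "(real \<times> real \<Rightarrow> real) \<Rightarrow> real \<times> real \<Rightarrow> real \<times> real \<Rightarrow> real" where
  "second_differential f p h = first_differential (\<lambda>q. first_differential f q h) p h"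

text \<open>That the second differential does not vanish at \<open>p\<close> is understood, like the classical
  condition that it be positive at \<open>p\<close>, for all increments \<open>h \<noteq> 0\<close>. Requiring only that the
  form is not identically zero would allow quotients \<open>f / g\<close> that are unbounded near \<open>p\<close>
  although the second derivatives are proportional, e.g. at the origin
  \<open>g = x^2 + 4 x y + y^2\<close> and \<open>f = g + x^3\<close>.\<close>

definition infinitely_small_second_order ::
    "(real \<times> real \<Rightarrow> real) \<Rightarrow> real \<times> real \<Rightarrow> bool" where
  "infinitely_small_second_order f p \<longleftrightarrow>
    (f \<longlongrightarrow> 0) (at p) \<and>
    (\<forall>h. first_differential f p h = 0) \<and>
    (\<forall>h. h \<noteq> 0 \<longrightarrow> second_differential f p h \<noteq> 0)"

end

theory Submission
  imports Defs
begin

text \<open>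
  At \<open>p = (x0, y0)\<close> both functions and both first differentials vanish, so Taylor's formula of order
  two leaves only the second differentials:
  \<open>f (p + h) = D h h / 2 + o(|h|\<^sup>2)\<close> and \<open>g (p + h) = E h h / 2 + o(|h|\<^sup>2)\<close>.
  The quotient of \<open>f\<close> and \<open>g\<close> tends to \<open>k\<close> exactly when the two quadratic forms satisfy
  \<open>D h h = k * E h h\<close> for all \<open>h\<close>
  (lemma \<open>tendsto_quotient_iff_leading_forms_proportional\<close>). On the ray through a fixed \<open>h \<noteq> 0\<close> the
  quotient tends to \<open>D h h / E h h\<close>, which must then be \<open>k\<close>. Conversely, proportional forms give
  \<open>f - k g = o(|h|\<^sup>2)\<close>, and \<open>|g|\<close> is at least a positive multiple of \<open>|h|\<^sup>2\<close> near \<open>p\<close>, because a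
  quadratic form without nontrivial zeros is bounded away from zero on the compact unit sphere.

  It remains to compare coefficients (lemma \<open>second_differentials_proportional_iff\<close>). The quadratic
  form determines \<open>f''\<^sub>x\<^sub>x\<close>, \<open>f''\<^sub>y\<^sub>y\<close> and the sum \<open>f''\<^sub>x\<^sub>y + f''\<^sub>y\<^sub>x\<close>; separating the two mixed
  derivatives requires their equality (\<open>second_derivative_symmetric\<close>). Both
  Taylor's formula and the symmetry follow from differentiability of the first derivative at the
  single point \<open>p\<close>: each time the mean value theorem reduces the claim to the first derivative, for
  which \<open>f' (p + h) = f' p + D h + o(|h|)\<close>.
\<close>

section \<open>Quotients of functions with a quadratic leading term\<close>

lemma filterlim_along_ray:
  fixes h :: "'a::real_normed_vector"
  assumes "h \<noteq> 0"
  shows "filterlim (\<lambda>t::real. t *\<^sub>R h) (at 0) (at 0)"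
  unfolding filterlim_at
  using assms by (auto intro!: tendsto_eq_intros simp: eventually_at_filter)

text \<open>Homogeneity of degree two makes \<open>A (t h) / t\<^sup>2\<close> constant, so that on a single ray the
  leading form can be read off as a limit. This is how a limit of \<open>F / G\<close> gives information on the
  forms.\<close>

lemma tendsto_along_ray:
  fixes F A :: "'a::real_normed_vector \<Rightarrow> real"
  assumes lead: "((\<lambda>h. (F h - A h) / norm h ^ 2) \<longlongrightarrow> 0) (at 0)"
    and hom: "\<And>t h. A (t *\<^sub>R h) = t ^ 2 * A h"
    and "h \<noteq> 0"
  shows "((\<lambda>t. F (t *\<^sub>R h) / t ^ 2) \<longlongrightarrow> A h) (at 0)"
proof -
  have "((\<lambda>t. (F (t *\<^sub>R h) - A (t *\<^sub>R h)) / norm (t *\<^sub>R h) ^ 2 * norm h ^ 2 + A h)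
      \<longlongrightarrow> 0 * norm h ^ 2 + A h) (at 0)"
    by (intro tendsto_intros filterlim_compose[OF lead filterlim_along_ray] \<open>h \<noteq> 0\<close>)
  moreover have "(F (t *\<^sub>R h) - A (t *\<^sub>R h)) / norm (t *\<^sub>R h) ^ 2 * norm h ^ 2 + A h
      = F (t *\<^sub>R h) / t ^ 2" if "t \<noteq> 0" for t
    using that \<open>h \<noteq> 0\<close> by (simp add: hom power_mult_distrib field_simps)
  ultimately show ?thesis
    by (auto elim!: Lim_transform_eventually simp: eventually_at_filter)
qed

text \<open>The constant is the minimum of \<open>|B|\<close> on the unit sphere, attained by compactness; homogeneity
  carries the bound from the sphere to all vectors.\<close>

lemma homogeneous_quadratic_lower_bound:
  fixes B :: "'a::euclidean_space \<Rightarrow> real"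
  assumes cont: "continuous_on UNIV B"
    and hom: "\<And>t h. B (t *\<^sub>R h) = t ^ 2 * B h"
    and nz: "\<And>h. h \<noteq> 0 \<Longrightarrow> B h \<noteq> 0"
  obtains c where "c > 0" "\<And>h. c * norm h ^ 2 \<le> \<bar>B h\<bar>"
proof -
  have "sphere (0::'a) 1 \<noteq> {}"
    by simp
  moreover have "continuous_on (sphere (0::'a) 1) (\<lambda>h. \<bar>B h\<bar>)"
    by (intro continuous_intros continuous_on_subset[OF cont]) auto
  ultimately obtain m where m: "m \<in> sphere 0 1" "\<And>h. h \<in> sphere 0 1 \<Longrightarrow> \<bar>B m\<bar> \<le> \<bar>B h\<bar>"
    using continuous_attains_inf[OF compact_sphere] by blast
  show thesis
  proof
    show "\<bar>B m\<bar> > 0"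
      using m(1) nz[of m] by (cases "m = 0") auto
  next
    fix h :: 'a
    show "\<bar>B m\<bar> * norm h ^ 2 \<le> \<bar>B h\<bar>"
    proof (cases "h = 0")
      case False
      have "B h = norm h ^ 2 * B (h /\<^sub>R norm h)"
        using hom[of "norm h" "h /\<^sub>R norm h"] False by simp
      moreover have "\<bar>B m\<bar> \<le> \<bar>B (h /\<^sub>R norm h)\<bar>"
        using False by (intro m(2)) simp
      ultimately show ?thesis
        by (simp add: abs_mult mult.commute[of "norm h ^ 2"] mult_right_mono)
    qed simp
  qed
qed

text \<open>Necessity is tested ray by ray. For sufficiency, \<open>F - k G\<close> is negligible against \<open>|h|\<^sup>2\<close>, while
  definiteness of \<open>B\<close> keeps \<open>|G|\<close> above a fixed multiple of \<open>|h|\<^sup>2\<close>; the uniformity in the direction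
  of \<open>h\<close> is what limits along rays could not provide.\<close>

lemma tendsto_quotient_iff_leading_forms_proportional:
  fixes F G A B :: "'a::euclidean_space \<Rightarrow> real"
  assumes F: "((\<lambda>h. (F h - A h) / norm h ^ 2) \<longlongrightarrow> 0) (at 0)"
    and G: "((\<lambda>h. (G h - B h) / norm h ^ 2) \<longlongrightarrow> 0) (at 0)"
    and homA: "\<And>t h. A (t *\<^sub>R h) = t ^ 2 * A h"
    and homB: "\<And>t h. B (t *\<^sub>R h) = t ^ 2 * B h"
    and contB: "continuous_on UNIV B"
    and nzB: "\<And>h. h \<noteq> 0 \<Longrightarrow> B h \<noteq> 0"
  shows "((\<lambda>h. F h / G h) \<longlongrightarrow> k) (at 0) \<longleftrightarrow> (\<forall>h. A h = k * B h)"
proof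
  assume lim: "((\<lambda>h. F h / G h) \<longlongrightarrow> k) (at 0)"
  show "\<forall>h. A h = k * B h"
  proof
    fix h :: 'a
    show "A h = k * B h"
    proof (cases "h = 0")
      case True
      then show ?thesis
        using homA[of 0 0] homB[of 0 0] by simp
    next
      case False
      from filterlim_compose[OF lim filterlim_along_ray[OF False]]
      have "((\<lambda>t. F (t *\<^sub>R h) / G (t *\<^sub>R h)) \<longlongrightarrow> k) (at 0)" .
      moreover have "((\<lambda>t. (F (t *\<^sub>R h) / t ^ 2) / (G (t *\<^sub>R h) / t ^ 2)) \<longlongrightarrow> A h / B h) (at 0)"
        using False
        by (intro tendsto_divide tendsto_along_ray[OF F homA] tendsto_along_ray[OF G homB] nzB)
      then have "((\<lambda>t. F (t *\<^sub>R h) / G (t *\<^sub>R h)) \<longlongrightarrow> A h / B h) (at 0)"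
        by (rule Lim_transform_eventually) (simp add: eventually_at_filter)
      ultimately have "k = A h / B h"
        using tendsto_unique trivial_limit_at by blast
      then show ?thesis
        using nzB[OF False] by simp
    qed
  qed
next
  assume proportional: "\<forall>h. A h = k * B h"
  obtain c where c: "c > 0" "\<And>h. c * norm h ^ 2 \<le> \<bar>B h\<bar>"
    using homogeneous_quadratic_lower_bound[OF contB homB nzB] by blast
  have "((\<lambda>h. (F h - A h) / norm h ^ 2 - k * ((G h - B h) / norm h ^ 2)) \<longlongrightarrow> 0 - k * 0) (at 0)"
    by (intro tendsto_intros F G)
  moreover have "(F h - A h) / norm h ^ 2 - k * ((G h - B h) / norm h ^ 2)
      = (F h - k * G h) / norm h ^ 2" for h
  proof -
    have "F h - k * G h = (F h - A h) - k * (G h - B h)"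
      using proportional by (simp add: right_diff_distrib)
    then show ?thesis
      by (simp add: diff_divide_distrib right_diff_distrib)
  qed
  ultimately have num: "((\<lambda>h. (F h - k * G h) / norm h ^ 2) \<longlongrightarrow> 0) (at 0)"
    by simp
  \<comment> \<open>Half of the lower bound \<open>c\<close> for \<open>B\<close> is given up to absorb the remainder \<open>G - B\<close>.\<close>
  have "\<forall>\<^sub>F h in at 0. norm ((G h - B h) / norm h ^ 2) < c / 2"
    using order_tendstoD(2)[OF tendsto_norm[OF G], of "c / 2"] c(1) by simp
  then have small: "\<forall>\<^sub>F h in at 0. c / 2 * norm h ^ 2 \<le> \<bar>G h\<bar> \<and> h \<noteq> 0"
    using eventually_neq_at_within[of 0 0 UNIV]
  proof eventually_elim
    case (elim h)
    then have "\<bar>G h - B h\<bar> < c / 2 * norm h ^ 2"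
      by (simp add: pos_divide_less_eq)
    moreover have "2 * (c / 2 * norm h ^ 2) \<le> \<bar>B h\<bar>"
      using c(2)[of h] by simp
    ultimately show ?case
      using elim by linarith
  qed
  have "\<forall>\<^sub>F h in at 0. norm (F h / G h - k) \<le> norm ((F h - k * G h) / norm h ^ 2) * (2 / c)"
    using small
  proof eventually_elim
    case (elim h)
    have pos: "c / 2 * norm h ^ 2 > 0"
      using elim c(1) by simp
    then have "G h \<noteq> 0"
      using elim by auto
    then have "F h / G h - k = (F h - k * G h) / G h"
      by (simp add: diff_divide_distrib)
    then have "norm (F h / G h - k) = \<bar>F h - k * G h\<bar> / \<bar>G h\<bar>"
      by simp
    also have "\<dots> \<le> \<bar>F h - k * G h\<bar> / (c / 2 * norm h ^ 2)"
      using elim pos by (intro divide_left_mono) auto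
    finally show ?case
      by (simp add: mult.commute)
  qed
  then have "((\<lambda>h. F h / G h - k) \<longlongrightarrow> 0) (at 0)"
    by (rule tendsto_0_le[OF num])
  then show "((\<lambda>h. F h / G h) \<longlongrightarrow> k) (at 0)"
    by (rule LIM_zero_cancel)
qed

section \<open>Second-order Frechet derivatives\<close>

lemma has_derivative_along_line:
  fixes f :: "'a::real_normed_vector \<Rightarrow> real"
  assumes "(f has_derivative f') (at (q + s *\<^sub>R v))"
  shows "((\<lambda>s. f (q + s *\<^sub>R v)) has_derivative (\<lambda>x. x * f' v)) (at s within S)"
proof -
  have "((\<lambda>s. q + s *\<^sub>R v) has_derivative (\<lambda>x. 0 + x *\<^sub>R v)) (at s within S)"
    by (intro has_derivative_add has_derivative_const has_derivative_scaleR_left has_derivative_ident)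
  from has_derivative_compose[OF this assms] show ?thesis
    by (simp add: linear_scale[OF has_derivative_linear[OF assms]])
qed

text \<open>Second-order differentiability at a single point. The second differential is \<open>\<lambda>h. D h h\<close>, where the
  argument of \<open>D\<close> is the increment of the point and that of \<open>D h\<close> the direction of the first
  derivative.\<close>

locale second_derivative =
  fixes f :: "'a::real_normed_vector \<Rightarrow> real"
    and f' :: "'a \<Rightarrow> 'a \<Rightarrow>\<^sub>L real"
    and D :: "'a \<Rightarrow> 'a \<Rightarrow>\<^sub>L real"
    and p :: 'a
  assumes first: "\<forall>\<^sub>F q in nhds p. (f has_derivative f' q) (at q)"
    and second: "(f' has_derivative D) (at p)"
begin

lemma linear_D: "linear D"
  using has_derivative_linear[OF second] .

lemma has_derivative_at_point: "(f has_derivative f' p) (at p)"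
  using first by (rule eventually_nhds_x_imp_x)

text \<open>The function \<open>F\<close> stands for any expression of the directional derivative of \<open>f\<close> along \<open>u\<close>. It
  has to agree with \<open>f' q u\<close> only where \<open>f'\<close> is known to be the derivative, so that it can be a partial
  derivative or a first differential, whose values elsewhere are arbitrary.\<close>

lemma has_derivative_of_directional_derivative:
  assumes "\<And>q. (f has_derivative f' q) (at q) \<Longrightarrow> F q = f' q u"
  shows "(F has_derivative (\<lambda>h. D h u)) (at p)"
proof (rule has_derivative_transform_eventually)
  show "((\<lambda>q. f' q u) has_derivative (\<lambda>h. D h u)) (at p)"
    by (rule bounded_linear.has_derivative[OF blinfun.bounded_linear_left second])
  show "\<forall>\<^sub>F q in at p. f' q u = F q"
    using first unfolding eventually_at_filter by (auto elim!: eventually_mono simp: assms)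
  show "f' p u = F p"
    using assms[OF has_derivative_at_point] by simp
qed simp

lemma continuous_on_second_differential: "continuous_on S (\<lambda>h. D h h)"
  using has_derivative_bounded_linear[OF second]
  by (intro continuous_intros linear_continuous_on)

lemma second_differential_homogeneous: "D (t *\<^sub>R h) (t *\<^sub>R h) = t ^ 2 * D h h"
  by (simp add: linear_scale[OF linear_D] blinfun.bilinear_simps power2_eq_square)

text \<open>Differentiability of \<open>f'\<close> at \<open>p\<close>, evaluated in a direction \<open>u\<close>. The estimate is the sole
  property of \<open>D\<close>, besides its linearity, on which Taylor's formula and the symmetry rest.\<close>

lemma linearization_of_first_derivative:
  assumes "e > 0"
  obtains d where "d > 0"
    "\<And>h. norm h < d \<Longrightarrow> (f has_derivative f' (p + h)) (at (p + h))"
    "\<And>h u. norm h < d \<Longrightarrow> \<bar>f' (p + h) u - f' p u - D h u\<bar> \<le> e * norm h * norm u"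
proof -
  obtain d1 where d1: "d1 > 0" "\<And>q. dist q p < d1 \<Longrightarrow> (f has_derivative f' q) (at q)"
    using first unfolding eventually_nhds_metric by blast
  obtain d2 where d2: "d2 > 0"
    "\<And>q. norm (q - p) < d2 \<Longrightarrow> norm (f' q - f' p - D (q - p)) \<le> e * norm (q - p)"
    using second \<open>e > 0\<close> unfolding has_derivative_at_alt by blast
  show thesis
  proof
    show "min d1 d2 > 0"
      using d1 d2 by simp
    fix h :: 'a
    assume h: "norm h < min d1 d2"
    then show "(f has_derivative f' (p + h)) (at (p + h))"
      by (intro d1) (simp add: dist_norm)
    fix u
    have "\<bar>(f' (p + h) - f' p - D h) u\<bar> \<le> norm (f' (p + h) - f' p - D h) * norm u"
      using norm_blinfun[of "f' (p + h) - f' p - D h" u] by simp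
    also have "\<dots> \<le> e * norm h * norm u"
      using d2(2)[of "p + h"] h by (intro mult_right_mono) auto
    finally show "\<bar>f' (p + h) u - f' p u - D h u\<bar> \<le> e * norm h * norm u"
      by (simp add: blinfun.bilinear_simps)
  qed
qed

text \<open>Along the segment from \<open>p\<close> to \<open>p + h\<close>, the remainder
  \<open>\<phi> t = f (p + t h) - t f' p h - t\<^sup>2 D h h / 2\<close> has the derivative
  \<open>f' (p + t h) h - f' p h - D (t h) h\<close>, which is of order \<open>o(|h|\<^sup>2)\<close> by linearization.\<close>

lemma second_order_Taylor_bound:
  assumes "e > 0"
  obtains d where "d > 0"
    "\<And>h. norm h < d \<Longrightarrow> \<bar>f (p + h) - f p - f' p h - D h h / 2\<bar> \<le> e * norm h ^ 2"
proof -
  obtain d where d: "d > 0"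
    "\<And>h. norm h < d \<Longrightarrow> (f has_derivative f' (p + h)) (at (p + h))"
    "\<And>h u. norm h < d \<Longrightarrow> \<bar>f' (p + h) u - f' p u - D h u\<bar> \<le> e * norm h * norm u"
    using linearization_of_first_derivative[OF assms] by blast
  show thesis
  proof
    fix h :: 'a
    assume h: "norm h < d"
    have scaled: "norm (t *\<^sub>R h) < d" if "0 \<le> t" "t \<le> 1" for t
      using that h mult_left_le_one_le[of "norm h" t] by simp
    define \<phi> where "\<phi> t = f (p + t *\<^sub>R h) - t * f' p h - t ^ 2 * (D h h / 2)" for t
    define \<phi>' where "\<phi>' t = f' (p + t *\<^sub>R h) h - f' p h - D (t *\<^sub>R h) h" for t
    have "(\<phi> has_derivative (\<lambda>s. s * \<phi>' t)) (at t within {0..1})" if "0 \<le> t" "t \<le> 1" for t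
    proof -
      note has_derivative_along_line[OF d(2)[OF scaled[OF that]], derivative_intros]
      show ?thesis
        unfolding \<phi>_def \<phi>'_def
        by (rule derivative_eq_intros refl)+
          (simp add: linear_scale[OF linear_D] blinfun.bilinear_simps algebra_simps)
    qed
    from mvt_simple[OF zero_less_one this]
    obtain t where t: "0 < t" "t < 1" "\<phi> 1 - \<phi> 0 = \<phi>' t"
      by auto
    have "\<bar>\<phi>' t\<bar> \<le> e * norm (t *\<^sub>R h) * norm h"
      unfolding \<phi>'_def using d(3)[OF scaled] t by simp
    also have "\<dots> = t * (e * norm h ^ 2)"
      using t by (simp add: power2_eq_square)
    also have "\<dots> \<le> e * norm h ^ 2"
      using t assms by (intro mult_left_le_one_le) auto
    finally show "\<bar>f (p + h) - f p - f' p h - D h h / 2\<bar> \<le> e * norm h ^ 2"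
      using t(3) by (simp add: \<phi>_def algebra_simps)
  qed (rule d)
qed

lemma second_order_Taylor:
  "((\<lambda>h. (f (p + h) - f p - f' p h - D h h / 2) / norm h ^ 2) \<longlongrightarrow> 0) (at 0)"
proof (rule tendstoI)
  fix e :: real
  assume "e > 0"
  then have "e / 2 > 0"
    by simp
  then obtain d where d: "d > 0"
    "\<And>h. norm h < d \<Longrightarrow> \<bar>f (p + h) - f p - f' p h - D h h / 2\<bar> \<le> e / 2 * norm h ^ 2"
    using second_order_Taylor_bound by blast
  have "\<bar>f (p + h) - f p - f' p h - D h h / 2\<bar> / norm h ^ 2 < e" if "h \<noteq> 0" "norm h < d" for h
  proof -
    have "\<bar>f (p + h) - f p - f' p h - D h h / 2\<bar> / norm h ^ 2 \<le> e / 2"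
      using d(2)[OF that(2)] that(1) by (subst pos_divide_le_eq) simp_all
    also have "\<dots> < e"
      using \<open>e > 0\<close> by simp
    finally show ?thesis .
  qed
  then show "\<forall>\<^sub>F h in at 0. dist ((f (p + h) - f p - f' p h - D h h / 2) / norm h ^ 2) 0 < e"
    unfolding eventually_at using d(1) by (auto simp: dist_norm)
qed

text \<open>Regard the second difference as the increment, over \<open>[0, t]\<close>, of
  \<open>\<psi> s = f (p + t v + s u) - f (p + s u)\<close>. The mean value theorem turns it into \<open>t\<close> times
  \<open>f' (p + s u + t v) u - f' (p + s u) u\<close>, and linearizing both terms at \<open>p\<close> leaves
  \<open>t (D (s u + t v) u - D (s u) u) = t\<^sup>2 D v u\<close>: the intermediate point \<open>s\<close> drops out.\<close>

lemma second_difference_bound: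
  assumes "e > 0"
    and d: "\<And>h. norm h < d \<Longrightarrow> (f has_derivative f' (p + h)) (at (p + h))"
    "\<And>h u. norm h < d \<Longrightarrow> \<bar>f' (p + h) u - f' p u - D h u\<bar> \<le> e * norm h * norm u"
    and "t > 0" and small: "t * (norm u + norm v) < d"
  shows "\<bar>f (p + t *\<^sub>R u + t *\<^sub>R v) - f (p + t *\<^sub>R u) - f (p + t *\<^sub>R v) + f p - t ^ 2 * D v u\<bar>
    \<le> 2 * e * t ^ 2 * (norm u + norm v) ^ 2"
proof -
  define N where "N = norm u + norm v"
  have bound: "norm (s *\<^sub>R u + r *\<^sub>R v) \<le> t * N" if "0 \<le> s" "s \<le> t" "0 \<le> r" "r \<le> t" for s r
  proof -
    have "norm (s *\<^sub>R u + r *\<^sub>R v) \<le> s * norm u + r * norm v"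
      using that norm_triangle_ineq[of "s *\<^sub>R u" "r *\<^sub>R v"] by simp
    also have "\<dots> \<le> t * N"
      unfolding N_def distrib_left using that by (intro add_mono mult_right_mono) auto
    finally show ?thesis .
  qed
  \<comment> \<open>The summand \<open>0 *\<^sub>R v\<close> lets \<open>der\<close> and \<open>lin\<close> below serve both terms, with \<open>r = t\<close> and \<open>r = 0\<close>.\<close>
  define \<psi> where "\<psi> s = f (p + t *\<^sub>R v + s *\<^sub>R u) - f (p + 0 *\<^sub>R v + s *\<^sub>R u)" for s
  define \<psi>' where "\<psi>' s = f' (p + (s *\<^sub>R u + t *\<^sub>R v)) u - f' (p + (s *\<^sub>R u + 0 *\<^sub>R v)) u" for s
  have der: "((\<lambda>s. f (p + r *\<^sub>R v + s *\<^sub>R u))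
      has_derivative (\<lambda>x. x * f' (p + (s *\<^sub>R u + r *\<^sub>R v)) u)) (at s within {0..t})"
    if "0 \<le> s" "s \<le> t" "0 \<le> r" "r \<le> t" for s r
  proof -
    have "norm (s *\<^sub>R u + r *\<^sub>R v) < d"
      using bound[OF that] small by (simp add: N_def)
    from d(1)[OF this] show ?thesis
      by (intro has_derivative_along_line) (simp add: ac_simps)
  qed
  have "(\<psi> has_derivative (\<lambda>x. x * \<psi>' s)) (at s within {0..t})" if "0 \<le> s" "s \<le> t" for s
    using has_derivative_diff[OF der[of s t] der[of s 0]] that \<open>t > 0\<close>
    unfolding \<psi>_def \<psi>'_def by (simp add: right_diff_distrib)
  from mvt_simple[OF \<open>t > 0\<close> this]
  obtain s where s: "0 < s" "s < t" "\<psi> t - \<psi> 0 = t * \<psi>' s"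
    by auto
  have lin: "\<bar>f' (p + (s *\<^sub>R u + r *\<^sub>R v)) u - f' p u - D (s *\<^sub>R u + r *\<^sub>R v) u\<bar> \<le> e * (t * N) * N"
    if "0 \<le> r" "r \<le> t" for r
  proof -
    have b: "norm (s *\<^sub>R u + r *\<^sub>R v) \<le> t * N"
      using s that by (intro bound) auto
    have "\<bar>f' (p + (s *\<^sub>R u + r *\<^sub>R v)) u - f' p u - D (s *\<^sub>R u + r *\<^sub>R v) u\<bar>
        \<le> e * norm (s *\<^sub>R u + r *\<^sub>R v) * norm u"
      using b small by (intro d(2)) (simp add: N_def)
    also have "\<dots> \<le> e * (t * N) * N"
      using b \<open>e > 0\<close> \<open>t > 0\<close> by (intro mult_mono) (auto simp: N_def)
    finally show ?thesis .
  qed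
  have "D (s *\<^sub>R u + t *\<^sub>R v) u - D (s *\<^sub>R u + 0 *\<^sub>R v) u = t * D v u"
    by (simp add: linear_add[OF linear_D] linear_scale[OF linear_D] blinfun.bilinear_simps)
  then have "\<bar>\<psi>' s - t * D v u\<bar> \<le> 2 * (e * (t * N) * N)"
    unfolding \<psi>'_def using lin[of t] lin[of 0] \<open>t > 0\<close> by linarith
  then have "t * \<bar>\<psi>' s - t * D v u\<bar> \<le> t * (2 * (e * (t * N) * N))"
    using \<open>t > 0\<close> by (intro mult_left_mono) auto
  moreover have "t * \<bar>\<psi>' s - t * D v u\<bar> = \<bar>\<psi> t - \<psi> 0 - t ^ 2 * D v u\<bar>"
    using \<open>t > 0\<close> s(3) by (simp add: abs_mult_pos' algebra_simps power2_eq_square)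
  moreover have "\<psi> t - \<psi> 0
      = f (p + t *\<^sub>R u + t *\<^sub>R v) - f (p + t *\<^sub>R u) - f (p + t *\<^sub>R v) + f p"
    by (simp add: \<psi>_def add.assoc add.commute[of "t *\<^sub>R u"])
  moreover have "t * (2 * (e * (t * N) * N)) = 2 * e * t ^ 2 * N ^ 2"
    by (simp add: power2_eq_square)
  ultimately show ?thesis
    unfolding N_def by metis
qed

text \<open>The second difference does not change when \<open>u\<close> and \<open>v\<close> are exchanged, but it is close to
  \<open>t\<^sup>2 D v u\<close> and, by exchanging the roles, to \<open>t\<^sup>2 D u v\<close>. The error is an arbitrarily small multiple of
  \<open>t\<^sup>2\<close>.\<close>

theorem second_derivative_symmetric: "D u v = D v u"
proof -
  define N where "N = norm u + norm v"
  have le: "\<bar>D v u - D u v\<bar> \<le> 4 * N ^ 2 * e" if e: "e > 0" for e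
  proof -
    obtain d where d: "d > 0"
      "\<And>h. norm h < d \<Longrightarrow> (f has_derivative f' (p + h)) (at (p + h))"
      "\<And>h u. norm h < d \<Longrightarrow> \<bar>f' (p + h) u - f' p u - D h u\<bar> \<le> e * norm h * norm u"
      using linearization_of_first_derivative[OF e] by blast
    \<comment> \<open>Any \<open>t\<close> with \<open>t N < d\<close> will do; adding 1 covers \<open>N = 0\<close>.\<close>
    define t where "t = d / (N + 1)"
    have "N \<ge> 0"
      by (simp add: N_def)
    then have t: "t > 0" "t * N < d"
      using d(1) by (auto simp: t_def field_simps)
    have "\<bar>t ^ 2 * D v u - t ^ 2 * D u v\<bar> \<le> 4 * e * t ^ 2 * N ^ 2"
    proof -
      have "\<bar>f (p + t *\<^sub>R u + t *\<^sub>R v) - f (p + t *\<^sub>R u) - f (p + t *\<^sub>R v) + f p - t ^ 2 * D v u\<bar>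
          \<le> 2 * e * t ^ 2 * N ^ 2"
        using second_difference_bound[OF e d(2,3) t(1)] t(2) unfolding N_def by blast
      moreover have "\<bar>f (p + t *\<^sub>R v + t *\<^sub>R u) - f (p + t *\<^sub>R v) - f (p + t *\<^sub>R u) + f p
          - t ^ 2 * D u v\<bar> \<le> 2 * e * t ^ 2 * N ^ 2"
        using second_difference_bound[OF e d(2,3) t(1)] t(2)
        unfolding N_def add.commute[of "norm u"] by blast
      moreover have "p + t *\<^sub>R v + t *\<^sub>R u = p + t *\<^sub>R u + t *\<^sub>R v"
        by simp
      ultimately show ?thesis
        by (simp add: abs_le_iff)
    qed
    also have "t ^ 2 * D v u - t ^ 2 * D u v = t ^ 2 * (D v u - D u v)"
      by (rule right_diff_distrib[symmetric])
    also have "\<bar>\<dots>\<bar> = t ^ 2 * \<bar>D v u - D u v\<bar>"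
      by (simp add: abs_mult)
    also have "4 * e * t ^ 2 * N ^ 2 = t ^ 2 * (4 * N ^ 2 * e)"
      by simp
    finally show ?thesis
      using t(1) by (simp only: mult_le_cancel_left_pos zero_less_power)
  qed
  show ?thesis
  proof (rule ccontr)
    assume "D u v \<noteq> D v u"
    then have pos: "\<bar>D v u - D u v\<bar> > 0"
      by simp
    \<comment> \<open>This \<open>e\<close> makes the bound \<open>4 N\<^sup>2 e\<close> smaller than the difference that it bounds.\<close>
    have den: "4 * N ^ 2 + 1 > 0"
      by (simp add: add_nonneg_pos)
    have "\<bar>D v u - D u v\<bar> \<le> 4 * N ^ 2 * (\<bar>D v u - D u v\<bar> / (4 * N ^ 2 + 1))"
      using pos den by (intro le) simp
    then have "\<bar>D v u - D u v\<bar> * (4 * N ^ 2 + 1) \<le> 4 * N ^ 2 * \<bar>D v u - D u v\<bar>"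
      using den by (simp add: pos_le_divide_eq)
    then show False
      using pos by (simp add: algebra_simps)
  qed
qed

end

section \<open>Partial derivatives and differentials in the plane\<close>

lemma partial_x_eq:
  assumes "(F has_derivative F') (at q)"
  shows "partial_x F q = F' (1, 0)"
proof -
  have "((\<lambda>x. F ((0, snd q) + x *\<^sub>R (1, 0))) has_derivative (\<lambda>x. x * F' (1, 0))) (at (fst q))"
    using assms by (intro has_derivative_along_line) simp
  then have "((\<lambda>x. F (x, snd q)) has_field_derivative F' (1, 0)) (at (fst q))"
    by (simp add: has_field_derivative_def mult_commute_abs)
  then show ?thesis
    unfolding partial_x_def by (rule DERIV_imp_deriv)
qed

lemma partial_y_eq:
  assumes "(F has_derivative F') (at q)"
  shows "partial_y F q = F' (0, 1)"
proof -
  have "((\<lambda>y. F ((fst q, 0) + y *\<^sub>R (0, 1))) has_derivative (\<lambda>y. y * F' (0, 1))) (at (snd q))"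
    using assms by (intro has_derivative_along_line) simp
  then have "((\<lambda>y. F (fst q, y)) has_field_derivative F' (0, 1)) (at (snd q))"
    by (simp add: has_field_derivative_def mult_commute_abs)
  then show ?thesis
    unfolding partial_y_def by (rule DERIV_imp_deriv)
qed

lemma twice_differentiable_on_imp_second_derivative:
  assumes "open U" "p \<in> U" "twice_differentiable_on f U"
  obtains f' D where "second_derivative f f' D p"
proof -
  obtain f' where f': "\<forall>q\<in>U. (f has_derivative blinfun_apply (f' q)) (at q)"
    "\<forall>q\<in>U. f' differentiable (at q)"
    using assms(3) unfolding twice_differentiable_on_def by blast
  obtain D where D: "(f' has_derivative D) (at p)"
    using f'(2) assms(2) unfolding differentiable_def by blast
  show thesis
  proof
    show "second_derivative f f' D p"
      using f'(1) D assms(1,2)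
      by unfold_locales (auto intro: eventually_mono[OF eventually_nhds_in_open])
  qed
qed

locale plane_second_derivative = second_derivative f f' D p
  for f :: "real \<times> real \<Rightarrow> real" and f' D p
begin

lemma first_differential_eq: "first_differential f p h = f' p h"
  unfolding first_differential_def
  using frechet_derivative_at[OF has_derivative_at_point] by simp

lemma second_differential_eq: "second_differential f p h = D h h"
proof -
  have "((\<lambda>q. first_differential f q h) has_derivative (\<lambda>v. D v h)) (at p)"
    by (rule has_derivative_of_directional_derivative)
      (simp add: first_differential_def flip: frechet_derivative_at)
  from frechet_derivative_at[OF this] show ?thesis
    unfolding second_differential_def first_differential_def[of _ p] by metis
qed

lemma second_partials_eq:
  "partial_xx f p = D (1, 0) (1, 0)"
  "partial_xy f p = D (0, 1) (1, 0)"
  "partial_yx f p = D (1, 0) (0, 1)"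
  "partial_yy f p = D (0, 1) (0, 1)"
  by (intro partial_x_eq[OF has_derivative_of_directional_derivative]
      partial_y_eq[OF has_derivative_of_directional_derivative] partial_x_eq partial_y_eq;
      assumption)+

lemma second_differential_expansion:
  "D h h = partial_xx f p * fst h ^ 2 + (partial_xy f p + partial_yx f p) * fst h * snd h
    + partial_yy f p * snd h ^ 2"
proof -
  have "h = fst h *\<^sub>R (1, 0) + snd h *\<^sub>R (0, 1)"
    by (cases h) simp
  then have "D h h = D (fst h *\<^sub>R (1, 0) + snd h *\<^sub>R (0, 1)) (fst h *\<^sub>R (1, 0) + snd h *\<^sub>R (0, 1))"
    by simp
  also have "\<dots> = partial_xx f p * fst h ^ 2
      + (partial_xy f p + partial_yx f p) * fst h * snd h + partial_yy f p * snd h ^ 2"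
    unfolding linear_add[OF linear_D] linear_scale[OF linear_D] blinfun.bilinear_simps
      second_partials_eq
    by (simp add: algebra_simps power2_eq_square)
  finally show ?thesis .
qed

lemma mixed_partials_eq: "partial_xy f p = partial_yx f p"
  unfolding second_partials_eq by (rule second_derivative_symmetric)

text \<open>The limit assumption bears on punctured neighbourhoods only; that \<open>f p\<close> itself is zero comes from
  continuity of \<open>f\<close> at \<open>p\<close>.\<close>

lemma infinitely_small_leading_form:
  assumes "infinitely_small_second_order f p"
  shows "((\<lambda>h. (f (p + h) - D h h / 2) / norm h ^ 2) \<longlongrightarrow> 0) (at 0)"
    and "h \<noteq> 0 \<Longrightarrow> D h h \<noteq> 0"
proof -
  have "(f \<longlongrightarrow> f p) (at p)"
    using has_derivative_continuous[OF has_derivative_at_point] by (simp add: isContD)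
  then have "f p = 0"
    using assms tendsto_unique[OF trivial_limit_at]
    unfolding infinitely_small_second_order_def by blast
  moreover have "f' p h = 0" for h
    using assms unfolding infinitely_small_second_order_def first_differential_eq by blast
  ultimately show "((\<lambda>h. (f (p + h) - D h h / 2) / norm h ^ 2) \<longlongrightarrow> 0) (at 0)"
    using second_order_Taylor by simp
  show "D h h \<noteq> 0" if "h \<noteq> 0"
    using assms that unfolding infinitely_small_second_order_def second_differential_eq by blast
qed

end

text \<open>The vectors \<open>(1, 0)\<close>, \<open>(0, 1)\<close> and \<open>(1, 1)\<close> isolate the pure derivatives and the sum of the mixed
  ones; symmetry then halves this sum.\<close>

lemma second_differentials_proportional_iff:
  assumes "plane_second_derivative f f' D p" and "plane_second_derivative g g' E p"
  shows "(\<forall>h. D h h = k * E h h) \<longleftrightarrow>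
    partial_xx f p = k * partial_xx g p \<and> partial_xy f p = k * partial_xy g p \<and>
    partial_yx f p = k * partial_yx g p \<and> partial_yy f p = k * partial_yy g p"
    (is "_ \<longleftrightarrow> ?P")
proof -
  interpret f: plane_second_derivative f f' D p by fact
  interpret g: plane_second_derivative g g' E p by fact
  show ?thesis
  proof
    assume proportional: "\<forall>h. D h h = k * E h h"
    then have "D (1, 0) (1, 0) = k * E (1, 0) (1, 0)" "D (0, 1) (0, 1) = k * E (0, 1) (0, 1)"
      by blast+
    then have pure: "partial_xx f p = k * partial_xx g p" "partial_yy f p = k * partial_yy g p"
      unfolding f.second_partials_eq g.second_partials_eq .
    have "D (1, 1) (1, 1) = k * E (1, 1) (1, 1)"
      using proportional by blast
    then have "partial_xy f p + partial_yx f p = k * (partial_xy g p + partial_yx g p)"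
      unfolding f.second_differential_expansion g.second_differential_expansion
      using pure by (simp add: algebra_simps)
    then show ?P
      using pure f.mixed_partials_eq g.mixed_partials_eq by simp
  next
    assume ?P
    then show "\<forall>h. D h h = k * E h h"
      unfolding f.second_differential_expansion g.second_differential_expansion
      by (simp add: algebra_simps)
  qed
qed

theorem theorem2:
  fixes f g :: "real \<times> real \<Rightarrow> real"
    and x0 y0 k :: real
    and U :: "(real \<times> real) set"
  assumes "open U" and "(x0, y0) \<in> U"
    and "twice_differentiable_on f U" and "twice_differentiable_on g U"
    and "infinitely_small_second_order f (x0, y0)"
    and "infinitely_small_second_order g (x0, y0)"
    and "partial_xx f (x0, y0) \<noteq> 0" and "partial_xy f (x0, y0) \<noteq> 0"
    and "partial_yx f (x0, y0) \<noteq> 0" and "partial_yy f (x0, y0) \<noteq> 0"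
    and "partial_xx g (x0, y0) \<noteq> 0" and "partial_xy g (x0, y0) \<noteq> 0"
    and "partial_yx g (x0, y0) \<noteq> 0" and "partial_yy g (x0, y0) \<noteq> 0"
    and "k \<noteq> 0"
  shows "((\<lambda>p. f p / g p) \<longlongrightarrow> k) (at (x0, y0)) \<longleftrightarrow>
    partial_xx f (x0, y0) / partial_xx g (x0, y0) = k \<and>
    partial_xy f (x0, y0) / partial_xy g (x0, y0) = k \<and>
    partial_yx f (x0, y0) / partial_yx g (x0, y0) = k \<and>
    partial_yy f (x0, y0) / partial_yy g (x0, y0) = k"
proof -
  define p where "p = (x0, y0)"
  obtain f' D where "second_derivative f f' D p"
    using twice_differentiable_on_imp_second_derivative[OF assms(1-3)] unfolding p_def by blast
  then interpret f: plane_second_derivative f f' D p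
    by (simp add: plane_second_derivative_def)
  obtain g' E where "second_derivative g g' E p"
    using twice_differentiable_on_imp_second_derivative[OF assms(1,2,4)] unfolding p_def by blast
  then interpret g: plane_second_derivative g g' E p
    by (simp add: plane_second_derivative_def)
  have "((\<lambda>q. f q / g q) \<longlongrightarrow> k) (at p) \<longleftrightarrow> ((\<lambda>h. f (p + h) / g (p + h)) \<longlongrightarrow> k) (at 0)"
    by (rule LIM_offset_zero_iff) simp
  also have "\<dots> \<longleftrightarrow> (\<forall>h. D h h / 2 = k * (E h h / 2))"
    using assms(5,6)
    by (intro tendsto_quotient_iff_leading_forms_proportional continuous_intros
        f.infinitely_small_leading_form g.infinitely_small_leading_form
        g.continuous_on_second_differential)
      (auto simp: f.second_differential_homogeneous g.second_differential_homogeneous p_def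
        dest: g.infinitely_small_leading_form(2)[unfolded p_def])
  also have "\<dots> \<longleftrightarrow> (\<forall>h. D h h = k * E h h)"
    by simp
  also have "\<dots> \<longleftrightarrow>
      partial_xx f p = k * partial_xx g p \<and> partial_xy f p = k * partial_xy g p \<and>
      partial_yx f p = k * partial_yx g p \<and> partial_yy f p = k * partial_yy g p"
    by (rule second_differentials_proportional_iff) unfold_locales
  finally show ?thesis
    using assms(11-14) unfolding p_def by (simp add: divide_eq_eq)
qed

end
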